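(* Algorithm 3 (described in the context) returns a $\frac{1}{m(\log K+2)}$-approximation to (m-DAOC); that is, it returns a feasible $\{S_j\}_{j\in\mathcal M}$ whose objective value $\sum_{j\in\mathcal M}\theta_jR_j(S_j)$ is at least $\frac{1}{m(\log K+2)}$ times the optimal value of (m-DAOC).
   Context: Products $\mathcal N=\{1,\dots,n\}$ have revenues $r_i\ge0$. Customer segments $\mathcal M=\{1,\dots,m\}$ have arrival probabilities $\theta_j>0$, $\sum_j\theta_j=1$, and preference weights $v_{ij}>0$ ($i\in\mathcal N$, $j\in\mathcal M$). There are categories $C_1,\dots,C_K\subseteq\mathcal N$ ($K\ge1$, possibly overlapping) with thresholds $0\le\ell_k\le|C_k|$. Let $R_j(S)=\dfrac{\sum_{i\in S}r_iv_{ij}}{1+\sum_{i\in S}v_{ij}}$. (m-DAOC): maximize $\sum_{j\in\mathcal M}\theta_jR_j(S_j)$ over $S_j\subseteq\mathcal N$ ($j\in\mathcal M$) subject to $\sum_{j\in\mathcal M}\theta_j|S_j\cap C_k|\ge\ell_k$ for all $k\in\{1,\dots,K\}$. $\log$ is the natural logarithm. Algorithm 1 (single segment), with input weights $v_i>0$, revenues $r_i$ and integer thresholds $t_k\le|C_k|$ (possibly $t_k\le 0$, in which case constraint $k$ is void), and $R(S)=\sum_{i\in S}r_iv_i/(1+\sum_{i\in S}v_i)$: start with $\hat S=\varnothing$; while some $k$ has $|\hat S\cap C_k|<t_k$, set $c_i=|\{k: i\in C_k,\ |C_k\cap\hat S|<t_k\}|$ for $i\in\mathcal N\setminus\hat S$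 and add to $\hat S$ some $i^*\in\arg\min_{i\in\mathcal N\setminus\hat S}v_i/c_i$ (with $v_i/c_i=\infty$ if $c_i=0$); finally return some $\bar S\in\arg\max_{S\supseteq\hat S}R(S)$. Algorithm 3. For each $\ell\in\mathcal M$: for each $k$ set $$\ell_k^{(\ell)}=\left\lceil\frac{\ell_k-\sum_{j\in\mathcal M\setminus\{\ell\}}\theta_j|C_k|}{\theta_\ell}\right\rceil;$$ run Algorithm 1 with weights $v_i=v_{i\ell}$ and thresholds $t_k=\ell_k^{(\ell)}$, obtaining $\bar S^{(\ell)}$; set $S_\ell^{(\ell)}=\bar S^{(\ell)}$ and $S_j^{(\ell)}=\mathcal N$ for all $j\in\mathcal M\setminus\{\ell\}$. Return the collection among $\{S_j^{(\ell)}\}_{j\in\mathcal M}$, $\ell\in\mathcal M$, with the largest $\sum_{j}\theta_jR_j(S_j^{(\ell)})$. *)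

theory Defs
  imports Complex_Main "HOL-Library.Extended_Real"
begin

text \<open>
  Products are \<open>{1..n}\<close>, segments \<open>{1..m}\<close>, category indices \<open>{1..K}\<close>. The weight of product
  \<open>i\<close> in segment \<open>j\<close> is \<open>v i j\<close>; a collection of assortments is a function from segments to
  sets of products, of which only the values on \<open>{1..m}\<close> matter.
\<close>

definition revenue :: "(nat \<Rightarrow> real) \<Rightarrow> (nat \<Rightarrow> real) \<Rightarrow> nat set \<Rightarrow> real" where
  "revenue r w S = (\<Sum>i\<in>S. r i * w i) / (1 + (\<Sum>i\<in>S. w i))"

definition objective ::
  "nat \<Rightarrow> (nat \<Rightarrow> real) \<Rightarrow> (nat \<Rightarrow> real) \<Rightarrow> (nat \<Rightarrow> nat \<Rightarrow> real) \<Rightarrow> (nat \<Rightarrow> nat set) \<Rightarrow> real" where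
  "objective m r \<theta> v S = (\<Sum>j\<in>{1..m}. \<theta> j * revenue r (\<lambda>i. v i j) (S j))"

definition feasible ::
  "nat \<Rightarrow> nat \<Rightarrow> nat \<Rightarrow> (nat \<Rightarrow> real) \<Rightarrow> (nat \<Rightarrow> nat set) \<Rightarrow> (nat \<Rightarrow> real) \<Rightarrow> (nat \<Rightarrow> nat set) \<Rightarrow> bool"
where
  "feasible n m K \<theta> C l S \<longleftrightarrow>
     (\<forall>j\<in>{1..m}. S j \<subseteq> {1..n}) \<and>
     (\<forall>k\<in>{1..K}. (\<Sum>j\<in>{1..m}. \<theta> j * real (card (S j \<inter> C k))) \<ge> l k)"

text \<open>
  The supremum is attained: \<open>objective\<close> takes only finitely many values on feasible collections,
  and offering everything to every segment is feasible when \<open>l k \<le> card (C k)\<close>.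
\<close>

definition optimal_value ::
  "nat \<Rightarrow> nat \<Rightarrow> nat \<Rightarrow> (nat \<Rightarrow> real) \<Rightarrow> (nat \<Rightarrow> real) \<Rightarrow> (nat \<Rightarrow> nat \<Rightarrow> real) \<Rightarrow>
   (nat \<Rightarrow> nat set) \<Rightarrow> (nat \<Rightarrow> real) \<Rightarrow> real" where
  "optimal_value n m K r \<theta> v C l = (SUP S\<in>{S. feasible n m K \<theta> C l S}. objective m r \<theta> v S)"

text \<open>
  The algorithms break ties arbitrarily, so they are modelled as relations: a transition relation
  for the greedy loop and predicates describing all sets that can be returned.
\<close>

definition unmet :: "nat \<Rightarrow> (nat \<Rightarrow> nat set) \<Rightarrow> (nat \<Rightarrow> int) \<Rightarrow> nat set \<Rightarrow> nat set" where
  "unmet K C t S = {k \<in> {1..K}. int (card (S \<inter> C k)) < t k}"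

definition cover_count :: "nat \<Rightarrow> (nat \<Rightarrow> nat set) \<Rightarrow> (nat \<Rightarrow> int) \<Rightarrow> nat set \<Rightarrow> nat \<Rightarrow> nat" where
  "cover_count K C t S i = card {k \<in> unmet K C t S. i \<in> C k}"

definition cover_cost ::
  "nat \<Rightarrow> (nat \<Rightarrow> nat set) \<Rightarrow> (nat \<Rightarrow> real) \<Rightarrow> (nat \<Rightarrow> int) \<Rightarrow> nat set \<Rightarrow> nat \<Rightarrow> ereal" where
  "cover_cost K C w t S i =
     (if cover_count K C t S i = 0 then \<infinity> else ereal (w i / real (cover_count K C t S i)))"

inductive greedy_step ::
  "nat \<Rightarrow> nat \<Rightarrow> (nat \<Rightarrow> nat set) \<Rightarrow> (nat \<Rightarrow> real) \<Rightarrow> (nat \<Rightarrow> int) \<Rightarrow> nat set \<Rightarrow> nat set \<Rightarrow> bool"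
  for n K C w t where
  "unmet K C t S \<noteq> {} \<Longrightarrow> is_arg_min (cover_cost K C w t S) (\<lambda>i. i \<in> {1..n} - S) i
    \<Longrightarrow> greedy_step n K C w t S (insert i S)"

text \<open>Every execution of the loop ends, and it can only end by falsifying the loop condition.\<close>

definition greedy_terminates ::
  "nat \<Rightarrow> nat \<Rightarrow> (nat \<Rightarrow> nat set) \<Rightarrow> (nat \<Rightarrow> real) \<Rightarrow> (nat \<Rightarrow> int) \<Rightarrow> bool" where
  "greedy_terminates n K C w t \<longleftrightarrow>
     (\<nexists>X. X 0 = {} \<and> (\<forall>p::nat. greedy_step n K C w t (X p) (X (Suc p)))) \<and>
     (\<forall>S. (greedy_step n K C w t)\<^sup>*\<^sup>* {} S \<longrightarrow> unmet K C t S \<noteq> {} \<longrightarrow>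
        (\<exists>S'. greedy_step n K C w t S S'))"

definition single_segment_returns ::
  "nat \<Rightarrow> nat \<Rightarrow> (nat \<Rightarrow> real) \<Rightarrow> (nat \<Rightarrow> nat set) \<Rightarrow> (nat \<Rightarrow> real) \<Rightarrow> (nat \<Rightarrow> int) \<Rightarrow> nat set \<Rightarrow> bool"
where
  "single_segment_returns n K r C w t S \<longleftrightarrow>
     (\<exists>S0. (greedy_step n K C w t)\<^sup>*\<^sup>* {} S0 \<and> unmet K C t S0 = {} \<and>
        is_arg_max (revenue r w) (\<lambda>S. S0 \<subseteq> S \<and> S \<subseteq> {1..n}) S)"

definition residual_threshold ::
  "nat \<Rightarrow> (nat \<Rightarrow> real) \<Rightarrow> (nat \<Rightarrow> nat set) \<Rightarrow> (nat \<Rightarrow> real) \<Rightarrow> nat \<Rightarrow> nat \<Rightarrow> int" where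
  "residual_threshold m \<theta> C l s k =
     \<lceil>(l k - (\<Sum>j\<in>{1..m} - {s}. \<theta> j * real (card (C k)))) / \<theta> s\<rceil>"

definition candidate :: "nat \<Rightarrow> (nat \<Rightarrow> nat set) \<Rightarrow> nat \<Rightarrow> nat \<Rightarrow> nat set" where
  "candidate n B s = (\<lambda>j. if j = s then B s else {1..n})"

definition multi_segment_returns ::
  "nat \<Rightarrow> nat \<Rightarrow> nat \<Rightarrow> (nat \<Rightarrow> real) \<Rightarrow> (nat \<Rightarrow> real) \<Rightarrow> (nat \<Rightarrow> nat \<Rightarrow> real) \<Rightarrow>
   (nat \<Rightarrow> nat set) \<Rightarrow> (nat \<Rightarrow> real) \<Rightarrow> (nat \<Rightarrow> nat set) \<Rightarrow> bool" where
  "multi_segment_returns n m K r \<theta> v C l S \<longleftrightarrow>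
     (\<exists>B s. (\<forall>p\<in>{1..m}. single_segment_returns n K r C (\<lambda>i. v i p)
                          (residual_threshold m \<theta> C l p) (B p)) \<and>
        is_arg_max (\<lambda>p. objective m r \<theta> v (candidate n B p)) (\<lambda>p. p \<in> {1..m}) s \<and>
        S = candidate n B s)"

end

theory Submission
  imports Defs "HOL-Analysis.Harmonic_Numbers"
begin

text \<open>
  The approximation factor has two sources, one for each algorithm.

  For a single segment, the greedy loop solves a weighted multicover problem in which every product
  may be used once and helps at most \<open>K\<close> categories. Its result \<open>S0\<close> weighs at most
  \<open>harm K \<le> ln K + 1\<close> times as much as any set \<open>T\<close> that meets the thresholds
  (\<open>greedy_weight_le\<close>). As the final step maximises over all supersets of \<open>S0\<close>, the revenue
  of the returned set is at least that of \<open>S0 \<union> T\<close>. Compared with \<open>T\<close>, this union has no smaller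
  numerator, and its denominator is at most \<open>1 + harm K\<close> times as large; hence a factor of
  \<open>ln K + 2\<close> is lost (\<open>single_segment_approximation\<close>).

  For several segments, the residual threshold of segment \<open>p\<close> is the least integer coverage that
  segment \<open>p\<close> must supply when every other segment offers everything. So the component of
  any feasible collection at \<open>p\<close> meets it, and a collection that meets it at \<open>p\<close> and offers
  everything elsewhere is feasible. The \<open>m\<close> candidates together therefore earn at least
  \<open>1 / (ln K + 2)\<close> times the optimum, and the best of them earns at least the average.

  The weight bound is shown with a potential function in place of linear programming duality.
  Throughout the loop, each category \<open>k\<close> keeps a reserve \<open>A k\<close> of unchosen products of \<open>T\<close>,
  exactly as many as its remaining demand. When a product is added, each category it helps gives up
  one product of its reserve, namely the added one if it is there. The potential charges each
  \<open>i \<in> T\<close> its weight times \<open>harm a\<close>, where \<open>a\<close> is the number of reserves containing \<open>i\<close>.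
  Since the greedy choice minimises the weight per category helped, each step lowers the potential
  by at least the weight of the added product, and the potential starts at no more than
  \<open>harm K\<close> times the weight of \<open>T\<close>.
\<close>

section \<open>Harmonic numbers and double counting\<close>

lemma harm_le_ln_plus_1:
  assumes "n \<ge> 1"
  shows "harm n \<le> ln (real n) + 1"
  using euler_mascheroni_sequence_decreasing[of 1 n] assms by (simp add: harm_expand)

text \<open>The difference is a sum of \<open>b - a\<close> reciprocals of numbers that are at most \<open>c\<close>.\<close>

lemma harm_diff_ge:
  assumes "a \<le> b" "b \<le> c"
  shows "(real b - real a) / real c \<le> harm b - harm a"
  using assms
proof (induction b rule: dec_induct)
  case (step b)
  have "1 / real c \<le> inverse (real (Suc b))"
    using step.prems by (simp add: field_simps)
  then show ?case
    using step by (simp add: harm_Suc add_divide_distrib diff_divide_distrib)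
qed simp

lemma sum_card_incidence:
  assumes "finite T" "finite I" "\<And>k. k \<in> I \<Longrightarrow> A k \<subseteq> T"
  shows "(\<Sum>i\<in>T. card {k \<in> I. i \<in> A k}) = (\<Sum>k\<in>I. card (A k))"
proof (rule sum_multicount_gen[OF assms(1,2)])
  show "\<forall>k\<in>I. card {i \<in> T. i \<in> A k} = card (A k)"
    using assms(3) by (auto intro!: arg_cong[where f = card])
qed

section \<open>The weight of a greedy multicover\<close>

locale multicover =
  fixes n K :: nat and C :: "nat \<Rightarrow> nat set" and w :: "nat \<Rightarrow> real" and t :: "nat \<Rightarrow> int"
  assumes weight_pos: "i \<in> {1..n} \<Longrightarrow> w i > 0"
    and category_subset: "k \<in> {1..K} \<Longrightarrow> C k \<subseteq> {1..n}"
    and threshold_le: "k \<in> {1..K} \<Longrightarrow> t k \<le> int (card (C k))"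
begin

lemma finite_category: "k \<in> {1..K} \<Longrightarrow> finite (C k)"
  using category_subset finite_subset by blast

lemma finite_unmet: "finite (unmet K C t S)"
  by (simp add: unmet_def)

lemma ex_useful_product:
  assumes "unmet K C t S \<noteq> {}"
  obtains i where "i \<in> {1..n} - S" "cover_count K C t S i > 0"
proof -
  obtain k where k: "k \<in> {1..K}" "int (card (S \<inter> C k)) < t k"
    using assms by (auto simp: unmet_def)
  then have "card (S \<inter> C k) < card (C k)"
    using threshold_le[of k] by simp
  then have "\<not> C k \<subseteq> S"
    by (auto simp: Int_absorb1)
  then obtain i where i: "i \<in> C k" "i \<notin> S"
    by blast
  have "k \<in> {k \<in> unmet K C t S. i \<in> C k}"
    using k i by (simp add: unmet_def)
  then have "cover_count K C t S i > 0"
    unfolding cover_count_def using finite_unmet by (subst card_gt_0_iff) auto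
  with i k that category_subset show ?thesis by blast
qed

lemma greedy_step_possible:
  assumes "unmet K C t S \<noteq> {}"
  shows "\<exists>S'. greedy_step n K C w t S S'"
proof -
  obtain i where "i \<in> {1..n} - S"
    using ex_useful_product[OF assms] by blast
  then obtain j where "is_arg_min (cover_cost K C w t S) (\<lambda>i. i \<in> {1..n} - S) j"
    using ex_is_arg_min_if_finite[of "{1..n} - S" "cover_cost K C w t S"] by blast
  then show ?thesis
    using assms greedy_step.intros by blast
qed

lemma greedy_stepE:
  assumes "greedy_step n K C w t S S'"
  obtains i where "S' = insert i S" "i \<in> {1..n} - S"
    "cover_count K C t S i > 0"
    "\<And>j. j \<in> {1..n} - S \<Longrightarrow> cover_count K C t S j > 0 \<Longrightarrow>
       w i / real (cover_count K C t S i) \<le> w j / real (cover_count K C t S j)"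
proof -
  from assms obtain i where i: "S' = insert i S" "unmet K C t S \<noteq> {}"
    and min: "is_arg_min (cover_cost K C w t S) (\<lambda>i. i \<in> {1..n} - S) i"
    by (rule greedy_step.cases) blast
  have le: "cover_cost K C w t S i \<le> cover_cost K C w t S j" if "j \<in> {1..n} - S" for j
    using min that by (auto simp: is_arg_min_linorder)
  obtain j where j: "j \<in> {1..n} - S" "cover_count K C t S j > 0"
    using ex_useful_product[OF i(2)] by blast
  have pos: "cover_count K C t S i > 0"
    using le[OF j(1)] j(2) by (auto simp: cover_cost_def split: if_splits)
  show ?thesis
  proof (rule that[OF i(1) _ pos])
    show "i \<in> {1..n} - S"
      using min by (simp add: is_arg_min_def)
    show "w i / real (cover_count K C t S i) \<le> w j / real (cover_count K C t S j)"
      if "j \<in> {1..n} - S" "cover_count K C t S j > 0" for j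
      using le[OF that(1)] that(2) pos by (simp add: cover_cost_def)
  qed
qed

lemma greedy_step_card:
  assumes "greedy_step n K C w t S S'" "S \<subseteq> {1..n}"
  shows "S' \<subseteq> {1..n}" "card S' = Suc (card S)"
proof -
  obtain i where i: "S' = insert i S" "i \<in> {1..n} - S"
    using greedy_stepE[OF assms(1)] by blast
  moreover have "finite S"
    using assms(2) finite_subset by blast
  ultimately show "S' \<subseteq> {1..n}" "card S' = Suc (card S)"
    using assms(2) by auto
qed

lemma greedy_reachable_subset:
  assumes "(greedy_step n K C w t)\<^sup>*\<^sup>* {} S"
  shows "S \<subseteq> {1..n}"
  using assms by (induction rule: rtranclp_induct) (use greedy_step_card(1) in blast)+

lemma greedy_terminates: "greedy_terminates n K C w t"
proof -
  have False if X: "X 0 = {}" "\<And>p. greedy_step n K C w t (X p) (X (Suc p))" for X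
  proof -
    have "X p \<subseteq> {1..n} \<and> card (X p) = p" for p
      by (induction p) (use X greedy_step_card in \<open>simp, metis\<close>)
    then have "card (X (Suc n)) \<le> card {1..n}" "card (X (Suc n)) = Suc n"
      using card_mono[of "{1..n}"] by (blast, blast)
    then show False by simp
  qed
  then show ?thesis
    unfolding greedy_terminates_def using greedy_step_possible by blast
qed

lemma greedy_run_exists:
  obtains S where "(greedy_step n K C w t)\<^sup>*\<^sup>* {} S" "unmet K C t S = {}"
proof -
  define \<R> where "\<R> = {S. (greedy_step n K C w t)\<^sup>*\<^sup>* {} S}"
  have "\<R> \<subseteq> Pow {1..n}"
    using greedy_reachable_subset by (auto simp: \<R>_def)
  then have "finite \<R>"
    by (rule finite_subset) simp
  moreover have "\<R> \<noteq> {}"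
    by (auto simp: \<R>_def)
  ultimately obtain S where "is_arg_min (\<lambda>S. - int (card S)) (\<lambda>S. S \<in> \<R>) S"
    using ex_is_arg_min_if_finite by blast
  then have S: "S \<in> \<R>" and max: "\<And>S'. S' \<in> \<R> \<Longrightarrow> card S' \<le> card S"
    by (auto simp: is_arg_min_linorder)
  have "unmet K C t S = {}"
  proof (rule ccontr)
    assume "unmet K C t S \<noteq> {}"
    then obtain S' where step: "greedy_step n K C w t S S'"
      using greedy_step_possible by blast
    then have "S' \<in> \<R>"
      using S rtranclp.rtrancl_into_rtrancl[of "greedy_step n K C w t" "{}" S S'] by (simp add: \<R>_def)
    moreover have "card S' = Suc (card S)"
      using greedy_step_card(2)[OF step] greedy_reachable_subset S by (simp add: \<R>_def)
    ultimately show False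
      using max[of S'] by simp
  qed
  with S that show ?thesis
    by (simp add: \<R>_def)
qed

text \<open>
  The products of a competing cover \<open>T\<close> that are set aside to meet the demand left over by \<open>S\<close>.
\<close>

definition reserve :: "nat set \<Rightarrow> nat set \<Rightarrow> (nat \<Rightarrow> nat set) \<Rightarrow> bool" where
  "reserve T S A \<longleftrightarrow>
     (\<forall>k\<in>{1..K}. A k \<subseteq> T \<inter> C k - S \<and> card (A k) = nat (t k - int (card (S \<inter> C k))))"

definition reserve_count :: "(nat \<Rightarrow> nat set) \<Rightarrow> nat \<Rightarrow> nat" where
  "reserve_count A i = card {k \<in> {1..K}. i \<in> A k}"

definition potential :: "nat set \<Rightarrow> (nat \<Rightarrow> nat set) \<Rightarrow> real" where
  "potential T A = (\<Sum>i\<in>T. w i * harm (reserve_count A i))"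

lemma potential_nonneg: "T \<subseteq> {1..n} \<Longrightarrow> 0 \<le> potential T A"
  unfolding potential_def
  by (intro sum_nonneg mult_nonneg_nonneg harm_nonneg) (use weight_pos in force)

text \<open>A category whose demand is met has an empty reserve, so only unmet ones can count.\<close>

lemma reserve_count_le_cover_count:
  assumes "reserve T S A"
  shows "reserve_count A i \<le> cover_count K C t S i"
proof -
  have "k \<in> unmet K C t S \<and> i \<in> C k" if k: "k \<in> {1..K}" "i \<in> A k" for k
  proof -
    have "A k \<subseteq> C k" "card (A k) = nat (t k - int (card (S \<inter> C k)))"
      using assms k(1) by (auto simp: reserve_def)
    moreover from this have "card (A k) > 0"
      using k finite_category finite_subset card_gt_0_iff by blast
    ultimately show ?thesis
      using k by (auto simp: unmet_def)
  qed
  then show ?thesis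
    unfolding reserve_count_def cover_count_def using finite_unmet by (intro card_mono) auto
qed

text \<open>
  One product leaves the reserve of each category that \<open>i\<close> helps, so that all reserves shrink by
  \<open>cover_count\<close> in total. Removing \<open>i\<close> itself where possible keeps the reserves disjoint from the
  chosen set.
\<close>

lemma reserve_update:
  assumes res: "reserve T S A" and i: "i \<in> {1..n} - S" and S: "S \<subseteq> {1..n}"
  obtains A' where "reserve T (insert i S) A'" "\<And>k. k \<in> {1..K} \<Longrightarrow> A' k \<subseteq> A k"
    "(\<Sum>k\<in>{1..K}. card (A k)) = (\<Sum>k\<in>{1..K}. card (A' k)) + cover_count K C t S i"
proof -
  define P where "P k \<longleftrightarrow> k \<in> unmet K C t S \<and> i \<in> C k" for k
  define e where "e k = (if i \<in> A k then i else SOME x. x \<in> A k)" for k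
  define A' where "A' k = (if P k then A k - {e k} else A k)" for k
  have card_A': "card (A k) = card (A' k) + of_bool (P k)"
    and new_k: "A' k \<subseteq> T \<inter> C k - insert i S \<and>
      card (A' k) = nat (t k - int (card (insert i S \<inter> C k)))" if k: "k \<in> {1..K}" for k
  proof -
    have A: "A k \<subseteq> T \<inter> C k - S" "card (A k) = nat (t k - int (card (S \<inter> C k)))"
      using res k by (auto simp: reserve_def)
    have fin: "finite (A k)" "finite (S \<inter> C k)"
      using A(1) finite_category[OF k] by (meson finite_subset Diff_subset le_infE, simp)
    have demand: "card (insert i S \<inter> C k) = card (S \<inter> C k) + of_bool (i \<in> C k)"
      using i fin by (simp add: Int_insert_left)
    show 1: "card (A k) = card (A' k) + of_bool (P k)"
    proof (cases "P k")
      case True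
      then have "card (A k) > 0"
        using A(2) by (auto simp: P_def unmet_def)
      then have "A k \<noteq> {}"
        by auto
      then have "e k \<in> A k"
        by (auto simp: e_def intro: someI)
      then show ?thesis
        using True fin \<open>card (A k) > 0\<close> by (simp add: A'_def)
    qed (simp add: A'_def)
    have "i \<notin> A' k"
    proof
      assume "i \<in> A' k"
      then have "i \<in> A k" "\<not> P k"
        by (auto simp: A'_def e_def split: if_splits)
      moreover from \<open>i \<in> A k\<close> have "i \<in> C k" "card (A k) > 0"
        using A(1) fin card_gt_0_iff by (blast, blast)
      ultimately show False
        using A(2) k by (auto simp: P_def unmet_def)
    qed
    moreover have "A' k \<subseteq> A k"
      by (auto simp: A'_def)
    moreover have "card (A' k) = nat (t k - int (card (insert i S \<inter> C k)))"
      using 1 A(2) demand k by (auto simp: P_def unmet_def of_bool_def split: if_splits)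
    ultimately show "A' k \<subseteq> T \<inter> C k - insert i S \<and>
      card (A' k) = nat (t k - int (card (insert i S \<inter> C k)))"
      using A(1) by blast
  qed
  have "cover_count K C t S i = card {k \<in> {1..K}. P k}"
    by (auto simp: cover_count_def P_def unmet_def intro!: arg_cong[where f = card])
  also have "\<dots> = (\<Sum>k\<in>{1..K}. of_bool (P k))"
    by (simp add: sum_of_bool_eq Int_def)
  finally have "(\<Sum>k\<in>{1..K}. card (A k)) = (\<Sum>k\<in>{1..K}. card (A' k)) + cover_count K C t S i"
    using card_A' by (simp add: sum.distrib)
  with new_k show ?thesis
    by (intro that[of A']) (auto simp: reserve_def A'_def split: if_splits)
qed

text \<open>
  The total number of reserved products falls by \<open>cover_count\<close> of the added product \<open>i\<close>. It thus
  suffices that each of these units lowers the potential by the price \<open>w i / cover_count\<close> of a unit.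
  Every reserved product is unchosen, so by the greedy rule it offers units at no lower price, and
  its reserve count is at most its cover count, which is what \<open>harm_diff_ge\<close> needs.
\<close>

lemma greedy_step_potential:
  assumes step: "greedy_step n K C w t S S'"
    and S: "S \<subseteq> {1..n}" and T: "T \<subseteq> {1..n}" and res: "reserve T S A"
  obtains A' where "reserve T S' A'" "sum w S' + potential T A' \<le> sum w S + potential T A"
proof -
  let ?c = "cover_count K C t S"
  obtain i where i: "S' = insert i S" "i \<in> {1..n} - S" "?c i > 0"
    and min: "\<And>j. j \<in> {1..n} - S \<Longrightarrow> ?c j > 0 \<Longrightarrow> w i / real (?c i) \<le> w j / real (?c j)"
    using greedy_stepE[OF step] by blast
  obtain A' where A': "reserve T (insert i S) A'" "\<And>k. k \<in> {1..K} \<Longrightarrow> A' k \<subseteq> A k"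
    and total: "(\<Sum>k\<in>{1..K}. card (A k)) = (\<Sum>k\<in>{1..K}. card (A' k)) + ?c i"
    using reserve_update[OF res i(2) S] by blast
  define \<rho> where "\<rho> = w i / real (?c i)"
  have fin: "finite S" "finite T"
    using S T finite_subset by auto
  have count_sum: "(\<Sum>j\<in>T. reserve_count B j) = (\<Sum>k\<in>{1..K}. card (B k))"
    if "reserve T S0 B" for B S0
    unfolding reserve_count_def using that fin
    by (intro sum_card_incidence) (auto simp: reserve_def)
  \<comment> \<open>The potential of \<open>j\<close> drops by at least the price \<open>\<rho>\<close> per reserve that gives up \<open>j\<close>.\<close>
  have drop: "\<rho> * (real (reserve_count A j) - real (reserve_count A' j))
      \<le> w j * harm (reserve_count A j) - w j * harm (reserve_count A' j)" if j: "j \<in> T" for j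
  proof -
    let ?a = "reserve_count A j" and ?a' = "reserve_count A' j"
    have le: "?a' \<le> ?a"
      unfolding reserve_count_def using A'(2) by (intro card_mono) auto
    show ?thesis
    proof (cases "?a = 0")
      case True
      with le show ?thesis by simp
    next
      case False
      have a_le: "?a \<le> ?c j"
        using reserve_count_le_cover_count[OF res] .
      obtain k where "k \<in> {1..K}" "j \<in> A k"
        using False unfolding reserve_count_def by (metis (no_types, lifting) card.empty Collect_empty_eq)
      then have "j \<notin> S"
        using res by (auto simp: reserve_def)
      then have "\<rho> \<le> w j / real (?c j)"
        unfolding \<rho>_def using min[of j] j T False a_le by auto
      then have "\<rho> * (real ?a - real ?a') \<le> w j / real (?c j) * (real ?a - real ?a')"
        using le by (intro mult_right_mono) auto
      also have "\<dots> = w j * ((real ?a - real ?a') / real (?c j))"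
        by simp
      also have "\<dots> \<le> w j * (harm ?a - harm ?a')"
        using harm_diff_ge[OF le a_le] weight_pos[of j] j T by (intro mult_left_mono) auto
      finally show ?thesis
        by (simp add: algebra_simps)
    qed
  qed
  have "w i = \<rho> * real (?c i)"
    using i(3) by (simp add: \<rho>_def)
  also have "real (?c i) = real (\<Sum>j\<in>T. reserve_count A j) - real (\<Sum>j\<in>T. reserve_count A' j)"
    using total count_sum[OF res] count_sum[OF A'(1)] by simp
  also have "\<rho> * \<dots> = (\<Sum>j\<in>T. \<rho> * (real (reserve_count A j) - real (reserve_count A' j)))"
    by (simp add: sum_distrib_left sum_subtractf right_diff_distrib)
  also have "\<dots> \<le> potential T A - potential T A'"
    unfolding potential_def sum_subtractf[symmetric] using drop by (intro sum_mono)
  finally have "w i \<le> potential T A - potential T A'" .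
  then show ?thesis
    using i A'(1) fin by (intro that[of A']) auto
qed

lemma greedy_weight_le:
  assumes run: "(greedy_step n K C w t)\<^sup>*\<^sup>* {} S"
    and T: "T \<subseteq> {1..n}" and cover: "unmet K C t T = {}"
  shows "sum w S \<le> harm K * sum w T"
proof -
  have "\<exists>B. B \<subseteq> T \<inter> C k \<and> card B = nat (t k)" if "k \<in> {1..K}" for k
  proof -
    have "nat (t k) \<le> card (T \<inter> C k)"
      using cover that by (force simp: unmet_def)
    then show ?thesis
      by (metis obtain_subset_with_card_n)
  qed
  then obtain A0 where A0: "\<And>k. k \<in> {1..K} \<Longrightarrow> A0 k \<subseteq> T \<inter> C k \<and> card (A0 k) = nat (t k)"
    by metis
  have "\<exists>A. reserve T S A \<and> sum w S + potential T A \<le> harm K * sum w T"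
    using run
  proof (induction rule: rtranclp_induct)
    case base
    have "reserve_count A0 i \<le> K" for i
    proof -
      have "reserve_count A0 i \<le> card {1..K}"
        unfolding reserve_count_def by (intro card_mono) auto
      then show ?thesis by simp
    qed
    then have "potential T A0 \<le> (\<Sum>i\<in>T. w i * harm K)"
      unfolding potential_def using weight_pos T
      by (intro sum_mono mult_left_mono harm_mono) (auto intro!: less_imp_le)
    moreover have "reserve T {} A0"
      using A0 by (simp add: reserve_def)
    ultimately show ?case
      by (auto simp: sum_distrib_left mult.commute)
  next
    case (step S S')
    obtain A where A: "reserve T S A" "sum w S + potential T A \<le> harm K * sum w T"
      using step.IH by blast
    obtain A' where "reserve T S' A'" "sum w S' + potential T A' \<le> sum w S + potential T A"
      by (rule greedy_step_potential[OF step.hyps(2) greedy_reachable_subset[OF step.hyps(1)] T A(1)])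
    with A(2) show ?case
      by (intro exI[of _ A']) simp
  qed
  then obtain A where "sum w S + potential T A \<le> harm K * sum w T"
    by blast
  with potential_nonneg[OF T, of A] show ?thesis
    by simp
qed

end

section \<open>One segment\<close>

lemma revenue_nonneg:
  assumes "\<And>i. i \<in> S \<Longrightarrow> r i \<ge> 0" "\<And>i. i \<in> S \<Longrightarrow> w i \<ge> 0"
  shows "revenue r w S \<ge> 0"
  unfolding revenue_def using assms
  by (intro divide_nonneg_nonneg sum_nonneg add_nonneg_nonneg mult_nonneg_nonneg) auto

lemma revenue_Un_ge:
  assumes fin: "finite S" "finite T"
    and r: "\<And>i. i \<in> S \<union> T \<Longrightarrow> r i \<ge> 0" and w: "\<And>i. i \<in> S \<union> T \<Longrightarrow> w i \<ge> 0"
    and le: "sum w S \<le> h * sum w T" and h: "h \<ge> 0"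
  shows "revenue r w T \<le> (1 + h) * revenue r w (S \<union> T)"
proof -
  let ?N = "\<Sum>i\<in>S \<union> T. r i * w i" and ?D = "1 + sum w (S \<union> T)"
  have nonneg: "sum w T \<ge> 0" "sum w (S \<union> T) \<ge> 0" "?N \<ge> 0"
    using r w by (auto intro!: sum_nonneg mult_nonneg_nonneg)
  have "sum w (S \<union> T) \<le> sum w S + sum w T"
    using sum_Un[of S T w] fin w sum_nonneg[of "S \<inter> T" w] by simp
  then have D: "?D \<le> (1 + h) * (1 + sum w T)"
    using le h by (simp add: algebra_simps)
  have "(\<Sum>i\<in>T. r i * w i) \<le> ?N"
    using fin r w by (intro sum_mono2) (auto intro!: mult_nonneg_nonneg)
  then have "revenue r w T \<le> ?N / (1 + sum w T)"
    unfolding revenue_def using nonneg by (intro divide_right_mono) auto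
  also have "\<dots> = (1 + h) * (?N / ((1 + h) * (1 + sum w T)))"
    using h by simp
  also have "\<dots> \<le> (1 + h) * (?N / ?D)"
    using D nonneg h by (intro mult_left_mono divide_left_mono mult_pos_pos) auto
  finally show ?thesis
    by (simp add: revenue_def)
qed

context multicover
begin

lemma single_segment_returns_exists: "\<exists>S. single_segment_returns n K r C w t S"
proof -
  obtain S0 where S0: "(greedy_step n K C w t)\<^sup>*\<^sup>* {} S0" "unmet K C t S0 = {}"
    using greedy_run_exists by blast
  let ?F = "{S. S0 \<subseteq> S \<and> S \<subseteq> {1..n}}"
  have "finite ?F"
    by (rule finite_subset[of _ "Pow {1..n}"]) auto
  moreover have "S0 \<in> ?F"
    using greedy_reachable_subset[OF S0(1)] by simp
  ultimately obtain S where "is_arg_min (\<lambda>S. - revenue r w S) (\<lambda>S. S \<in> ?F) S"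
    using ex_is_arg_min_if_finite[of ?F] by blast
  then have "is_arg_max (revenue r w) (\<lambda>S. S0 \<subseteq> S \<and> S \<subseteq> {1..n}) S"
    by (simp add: is_arg_min_def is_arg_max_def)
  with S0 show ?thesis
    unfolding single_segment_returns_def by blast
qed

lemma single_segment_returns_cover:
  assumes "single_segment_returns n K r C w t S"
  shows "S \<subseteq> {1..n}" "unmet K C t S = {}"
proof -
  obtain S0 where S0: "unmet K C t S0 = {}" "S0 \<subseteq> S" and S: "S \<subseteq> {1..n}"
    using assms by (auto simp: single_segment_returns_def is_arg_max_def)
  have "t k \<le> int (card (S \<inter> C k))" if "k \<in> {1..K}" for k
  proof -
    have "t k \<le> int (card (S0 \<inter> C k))"
      using S0(1) that by (force simp: unmet_def)
    also have "card (S0 \<inter> C k) \<le> card (S \<inter> C k)"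
      using S0(2) finite_category[OF that] by (intro card_mono) auto
    finally show ?thesis by simp
  qed
  then show "S \<subseteq> {1..n}" "unmet K C t S = {}"
    using S by (force simp: unmet_def)+
qed

lemma single_segment_approximation:
  assumes ret: "single_segment_returns n K r C w t S"
    and r: "\<And>i. i \<in> {1..n} \<Longrightarrow> r i \<ge> 0" and K: "K \<ge> 1"
    and T: "T \<subseteq> {1..n}" and cover: "unmet K C t T = {}"
  shows "revenue r w T \<le> (ln (real K) + 2) * revenue r w S"
proof -
  obtain S0 where S0: "(greedy_step n K C w t)\<^sup>*\<^sup>* {} S0"
    and max: "is_arg_max (revenue r w) (\<lambda>S. S0 \<subseteq> S \<and> S \<subseteq> {1..n}) S"
    using ret by (auto simp: single_segment_returns_def)
  have sub: "S0 \<subseteq> {1..n}" "S \<subseteq> {1..n}"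
    using greedy_reachable_subset[OF S0] max by (auto simp: is_arg_max_def)
  have w: "w i \<ge> 0" if "i \<in> {1..n}" for i
    using weight_pos[OF that] by simp
  have "revenue r w T \<le> (1 + harm K) * revenue r w (S0 \<union> T)"
    using sub T r w greedy_weight_le[OF S0 T cover]
    by (intro revenue_Un_ge harm_nonneg) (auto intro: finite_subset)
  also have "\<dots> \<le> (1 + harm K) * revenue r w S"
    using max sub T harm_nonneg[of K, where 'a = real]
    by (intro mult_left_mono) (auto simp: is_arg_max_linorder)
  also have "\<dots> \<le> (ln (real K) + 2) * revenue r w S"
    using harm_le_ln_plus_1[OF K] r w sub
    by (intro mult_right_mono revenue_nonneg) auto
  finally show ?thesis .
qed

end

section \<open>Several segments\<close>

text \<open>Rounding the residual threshold up loses nothing, as the coverage of a segment is an integer.\<close>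

lemma unmet_residual_threshold_empty_iff:
  assumes "\<theta> p > 0"
  shows "unmet K C (residual_threshold m \<theta> C l p) S = {} \<longleftrightarrow>
    (\<forall>k\<in>{1..K}. l k \<le> \<theta> p * real (card (S \<inter> C k)) + (\<Sum>j\<in>{1..m} - {p}. \<theta> j * real (card (C k))))"
proof -
  have "residual_threshold m \<theta> C l p k \<le> int (card (S \<inter> C k)) \<longleftrightarrow>
    l k \<le> \<theta> p * real (card (S \<inter> C k)) + (\<Sum>j\<in>{1..m} - {p}. \<theta> j * real (card (C k)))" for k
    using assms by (simp add: residual_threshold_def ceiling_le_iff pos_divide_le_eq algebra_simps)
  then show ?thesis
    by (auto simp: unmet_def not_less)
qed

lemma feasible_meets_residual_threshold:
  assumes \<theta>: "\<And>j. j \<in> {1..m} \<Longrightarrow> \<theta> j > 0" and C: "\<And>k. k \<in> {1..K} \<Longrightarrow> finite (C k)"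
    and feas: "feasible n m K \<theta> C l S" and p: "p \<in> {1..m}"
  shows "unmet K C (residual_threshold m \<theta> C l p) (S p) = {}"
proof -
  have "l k \<le> \<theta> p * real (card (S p \<inter> C k)) + (\<Sum>j\<in>{1..m} - {p}. \<theta> j * real (card (C k)))"
    if k: "k \<in> {1..K}" for k
  proof -
    have "l k \<le> (\<Sum>j\<in>{1..m}. \<theta> j * real (card (S j \<inter> C k)))"
      using feas k by (simp add: feasible_def)
    also have "\<dots> = \<theta> p * real (card (S p \<inter> C k)) + (\<Sum>j\<in>{1..m} - {p}. \<theta> j * real (card (S j \<inter> C k)))"
      using p by (simp add: sum.remove)
    also have "\<dots> \<le> \<theta> p * real (card (S p \<inter> C k)) + (\<Sum>j\<in>{1..m} - {p}. \<theta> j * real (card (C k)))"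
      using C[OF k] \<theta>
      by (intro add_left_mono sum_mono mult_left_mono) (simp_all add: card_mono less_imp_le)
    finally show ?thesis .
  qed
  then show ?thesis
    using unmet_residual_threshold_empty_iff[where \<theta> = \<theta> and p = p, OF \<theta>[OF p]] by blast
qed

lemma candidate_feasible:
  assumes \<theta>: "\<theta> p > 0" and C: "\<And>k. k \<in> {1..K} \<Longrightarrow> C k \<subseteq> {1..n}" and p: "p \<in> {1..m}"
    and B: "B p \<subseteq> {1..n}" "unmet K C (residual_threshold m \<theta> C l p) (B p) = {}"
  shows "feasible n m K \<theta> C l (candidate n B p)"
proof -
  have "l k \<le> (\<Sum>j\<in>{1..m}. \<theta> j * real (card (candidate n B p j \<inter> C k)))" if k: "k \<in> {1..K}" for k
  proof -
    have full: "{Suc 0..n} \<inter> C k = C k"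
      using C[OF k] by auto
    have "l k \<le> \<theta> p * real (card (B p \<inter> C k)) + (\<Sum>j\<in>{1..m} - {p}. \<theta> j * real (card (C k)))"
      using B(2) k unmet_residual_threshold_empty_iff[where \<theta> = \<theta> and p = p, OF \<theta>] by blast
    also have "\<dots> = (\<Sum>j\<in>{1..m}. \<theta> j * real (card (candidate n B p j \<inter> C k)))"
      using p by (simp add: sum.remove[of _ p] candidate_def full)
    finally show ?thesis .
  qed
  then show ?thesis
    using B(1) by (auto simp: feasible_def candidate_def)
qed

lemma objective_candidate_ge:
  assumes \<theta>: "\<And>j. j \<in> {1..m} \<Longrightarrow> \<theta> j > 0" and r: "\<And>i. i \<in> {1..n} \<Longrightarrow> r i \<ge> 0"
    and v: "\<And>i j. i \<in> {1..n} \<Longrightarrow> j \<in> {1..m} \<Longrightarrow> v i j > 0" and p: "p \<in> {1..m}"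
  shows "\<theta> p * revenue r (\<lambda>i. v i p) (B p) \<le> objective m r \<theta> v (candidate n B p)"
proof -
  let ?R = "\<lambda>j. \<theta> j * revenue r (\<lambda>i. v i j) (candidate n B p j)"
  have nonneg: "?R j \<ge> 0" if "j \<in> {1..m} - {p}" for j
    using that \<theta>[of j] r v[of _ j]
    by (intro mult_nonneg_nonneg revenue_nonneg) (auto simp: candidate_def intro!: less_imp_le)
  have "?R p \<le> sum ?R {1..m}"
    using sum_nonneg[of "{1..m} - {p}" ?R] nonneg p by (simp add: sum.remove[of _ p])
  then show ?thesis
    by (simp add: objective_def candidate_def)
qed

theorem theorem15:
  fixes n m K :: nat
    and r \<theta> l :: "nat \<Rightarrow> real"
    and v :: "nat \<Rightarrow> nat \<Rightarrow> real"
    and C :: "nat \<Rightarrow> nat set"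
  assumes "\<And>i. i \<in> {1..n} \<Longrightarrow> r i \<ge> 0"
    and "\<And>j. j \<in> {1..m} \<Longrightarrow> \<theta> j > 0"
    and "(\<Sum>j\<in>{1..m}. \<theta> j) = 1"
    and "\<And>i j. i \<in> {1..n} \<Longrightarrow> j \<in> {1..m} \<Longrightarrow> v i j > 0"
    and "K \<ge> 1"
    and "\<And>k. k \<in> {1..K} \<Longrightarrow> C k \<subseteq> {1..n}"
    and "\<And>k. k \<in> {1..K} \<Longrightarrow> 0 \<le> l k \<and> l k \<le> real (card (C k))"
  shows "(\<forall>p\<in>{1..m}. greedy_terminates n K C (\<lambda>i. v i p) (residual_threshold m \<theta> C l p)) \<and>
    (\<exists>S. multi_segment_returns n m K r \<theta> v C l S) \<and>
    (\<forall>S. multi_segment_returns n m K r \<theta> v C l S \<longrightarrow>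
       feasible n m K \<theta> C l S \<and>
       objective m r \<theta> v S
         \<ge> 1 / (real m * (ln (real K) + 2)) * optimal_value n m K r \<theta> v C l)"
proof -
  note r = assms(1) and \<theta> = assms(2) and v = assms(4) and K = assms(5) and C = assms(6)
  let ?t = "residual_threshold m \<theta> C l" and ?L = "ln (real K) + 2"
  have m: "m > 0"
    using assms(3) by (cases m) auto
  have L: "?L > 0"
    using K by (simp add: add_nonneg_pos)
  have finC: "finite (C k)" if "k \<in> {1..K}" for k
    using C[OF that] finite_subset by blast
  have mc: "multicover n K C (\<lambda>i. v i p) (?t p)" if p: "p \<in> {1..m}" for p
  proof
    \<comment> \<open>Offering everything to every segment is feasible, so the residual thresholds are satisfiable.\<close>
    have "feasible n m K \<theta> C l (\<lambda>_. {1..n})"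
      using assms(3,7) C by (simp add: feasible_def Int_absorb1 flip: sum_distrib_right)
    then have "unmet K C (?t p) {1..n} = {}"
      using feasible_meets_residual_threshold[where \<theta> = \<theta> and C = C and p = p and K = K,
          OF \<theta> finC _ p] by fast
    then show "?t p k \<le> int (card (C k))" if "k \<in> {1..K}" for k
      using that C[OF that] by (force simp: unmet_def Int_absorb1)
  qed (use v p C in auto)
  have terminates: "\<forall>p\<in>{1..m}. greedy_terminates n K C (\<lambda>i. v i p) (?t p)"
    using multicover.greedy_terminates[OF mc] by blast
  have returns: "\<exists>S. multi_segment_returns n m K r \<theta> v C l S"
  proof -
    have "\<forall>p\<in>{1..m}. \<exists>S. single_segment_returns n K r C (\<lambda>i. v i p) (?t p) S"
      using multicover.single_segment_returns_exists[OF mc] by blast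
    from bchoice[OF this] obtain B
      where B: "\<forall>p\<in>{1..m}. single_segment_returns n K r C (\<lambda>i. v i p) (?t p) (B p)"
      by blast
    have "{1..m} \<noteq> {}"
      using m by simp
    then obtain s
      where "is_arg_min (\<lambda>p. - objective m r \<theta> v (candidate n B p)) (\<lambda>p. p \<in> {1..m}) s"
      using ex_is_arg_min_if_finite[of "{1..m}"] by blast
    then have "is_arg_max (\<lambda>p. objective m r \<theta> v (candidate n B p)) (\<lambda>p. p \<in> {1..m}) s"
      by (simp add: is_arg_min_def is_arg_max_def)
    with B show ?thesis
      unfolding multi_segment_returns_def by blast
  qed
  have guarantee: "feasible n m K \<theta> C l S \<and>
      objective m r \<theta> v S \<ge> 1 / (real m * ?L) * optimal_value n m K r \<theta> v C l"
    if ret: "multi_segment_returns n m K r \<theta> v C l S" for S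
  proof -
    obtain B s where B: "\<And>p. p \<in> {1..m} \<Longrightarrow>
        single_segment_returns n K r C (\<lambda>i. v i p) (?t p) (B p)"
      and s: "s \<in> {1..m}" and S: "S = candidate n B s"
      and best: "\<And>p. p \<in> {1..m} \<Longrightarrow> objective m r \<theta> v (candidate n B p) \<le> objective m r \<theta> v S"
      using ret unfolding multi_segment_returns_def is_arg_max_linorder by blast
    have feas: "feasible n m K \<theta> C l S"
      unfolding S using multicover.single_segment_returns_cover[OF mc[OF s] B[OF s]]
      by (intro candidate_feasible \<theta> C s) auto
    have bound: "objective m r \<theta> v T \<le> real m * ?L * objective m r \<theta> v S"
      if T: "feasible n m K \<theta> C l T" for T
    proof -
      have "\<theta> p * revenue r (\<lambda>i. v i p) (T p) \<le> ?L * objective m r \<theta> v S" if p: "p \<in> {1..m}" for p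
      proof -
        have "T p \<subseteq> {1..n}"
          using T p by (simp add: feasible_def)
        then have "revenue r (\<lambda>i. v i p) (T p) \<le> ?L * revenue r (\<lambda>i. v i p) (B p)"
          using feasible_meets_residual_threshold[where \<theta> = \<theta> and C = C, OF \<theta> finC T p]
          by (intro multicover.single_segment_approximation[OF mc[OF p] B[OF p] r K])
        then have "\<theta> p * revenue r (\<lambda>i. v i p) (T p) \<le> ?L * (\<theta> p * revenue r (\<lambda>i. v i p) (B p))"
          using \<theta>[OF p] by (simp add: mult.left_commute)
        also have "\<dots> \<le> ?L * objective m r \<theta> v (candidate n B p)"
          by (intro mult_left_mono objective_candidate_ge \<theta> r v p less_imp_le[OF L])
        also have "\<dots> \<le> ?L * objective m r \<theta> v S"
          using best[OF p] L by (intro mult_left_mono) auto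
        finally show ?thesis .
      qed
      then have "objective m r \<theta> v T \<le> (\<Sum>p\<in>{1..m}. ?L * objective m r \<theta> v S)"
        unfolding objective_def by (intro sum_mono)
      then show ?thesis by simp
    qed
    have "optimal_value n m K r \<theta> v C l \<le> real m * ?L * objective m r \<theta> v S"
      unfolding optimal_value_def using feas bound by (intro cSUP_least) auto
    then have "optimal_value n m K r \<theta> v C l / (real m * ?L) \<le> objective m r \<theta> v S"
      using m L by (subst pos_divide_le_eq) (auto simp: mult.commute)
    then show ?thesis
      using feas by simp
  qed
  show ?thesis
    using terminates returns guarantee by blast
qed

end
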